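(* Let $(a,b)$ be coprime positive integers and let $(\mathcal{Q},d)$ be an uncoloured localization data compatible with the pair of weighted partitions $(a=\sum_l l a_l,\ b=\sum_l l b_l)$. Let $k\geq 2$ with $a_k\neq 0$, let $i_k$ be a source of $\mathcal{Q}$ of level $k$, and let $\hat J=N_{i_k}$ be its set of neighbours. Let $a'=\sum_l l a'_l$ be the weighted partition (of the same number $a$) obtained from $a=\sum_l la_l$ by replacing one part of size $k$ by one part of size $k-1$ and one part of size $1$. Then there exist a sink $j_t\in\hat J$ and subsets $J_1,J_2\subseteq\hat J$ with $\hat J=J_1\cup J_2$ and $J_1\cap J_2=\{j_t\}$ such that the following holds: if the vertex $i_k$ is replaced by two sources $i_1$ and $i_{k-1}$ of levels $1$ and $k-1$ respectively, with dimension $1$ at both, with $N_{i_1}=J_1$ and $N_{i_{k-1}}=J_2$ (one arrow to each neighbour), and the remaining quiver is left unchanged, then the resulting data is an (uncoloured) localization data compatible with the pair of weighted partitions $(a'=\sum_l l a'_l,\ b=\sum_l l b_l)$.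
   Context: All representations are over $\mathbb{C}$. A weighted partition of $a$ is an expression $a=\sum_{l\ge1} l a_l$ with integers $a_l\ge 0$ ($a_l$ is the number of parts of size $l$). $\mathcal{N}_m$ is the bipartite quiver with sources $i_{l,n}$ and sinks $j_{l,n}$ ($l,n\ge1$) and $m\cdot p\cdot q$ arrows from $i_{p,s}$ to $j_{q,t}$, with level function $l(i_{l,n})=l(j_{l,n})=l$. A pair of weighted partitions $(a=\sum la_l,b=\sum l b_l)$ is viewed as the dimension vector of $\mathcal{N}_m$ that is $1$ at $i_{l,n}$ for $1\le n\le a_l$ and at $j_{l,n}$ for $1\le n\le b_l$, and $0$ elsewhere. A localization data compatible with it is a pair $(\mathcal Q,d)$ with $\mathcal Q$ a finite subquiver of the universal covering quiver of $\mathcal N_m$ (which is a tree) and $d$ a dimension vector nonzero at every vertex of $\mathcal Q$, such that $\mathcal{Q}$ has a stable representation of dimension $d$ and such that for each vertex $q$ of $\mathcal N_m$ the entries of $d$ at the vertices of $\mathcal{Q}$ lying over $q$ sum to the entry at $q$ of the given dimension vector. "Uncoloured" means that one forgets which arrow of $\mathcal{N}_m$ each arrow of $\mathcal Q$ lies over. Concretely, an uncoloured localization data compatible with $(\sum la_l,\sum lb_l)$ is a finite tree $\mathcal Q$ whose vertices are partitioned into sources and sinks, all arrows going from sources to sinks, with a level $l(q)\in\mathbb{N}_{\ge1}$ on vertices such that there are exactly $a_l$ sources and $b_l$ sinks of level $l$ for every $l$, with $d_q=1$ for all vertices $q$, and such that $\mathcal Q$ has a stable representation of dimension vector $d$. Here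 stability is with respect to the slope $\mu(e)=\frac{\sum_{i\text{ source}}l(i)e_i}{\sum_{q}l(q)e_q}$: a representation $X$ is stable if $\mu(\underline{\dim}\,U)<\mu(\underline{\dim}\,X)$ for all proper nonzero subrepresentations $U$. $N_q$ denotes the set of neighbours of the vertex $q$. *)

theory Defs
  imports Complex_Main "HOL-Library.Function_Algebras"
begin

section \<open>Weighted partitions\<close>

text \<open>\<open>p l\<close> is the number of parts of size \<open>l\<close>.\<close>

definition weighted_partition :: "nat \<Rightarrow> (nat \<Rightarrow> nat) \<Rightarrow> bool" where
  "weighted_partition a p \<longleftrightarrow>
     p 0 = 0 \<and> finite {l. p l \<noteq> 0} \<and> (\<Sum>l | p l \<noteq> 0. l * p l) = a"

text \<open>The updates are sequential because for \<open>k = 2\<close> the sizes \<open>k - 1\<close> and \<open>1\<close> coincide, and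
  then two parts of size \<open>1\<close> are added.\<close>

definition split_part :: "nat \<Rightarrow> (nat \<Rightarrow> nat) \<Rightarrow> nat \<Rightarrow> nat" where
  "split_part k p =
     (let p1 = p(k := p k - 1); p2 = p1(k - 1 := p1 (k - 1) + 1) in p2(1 := p2 1 + 1))"


section \<open>Bipartite quivers with a level function\<close>

text \<open>An arrow is identified with its pair (source, sink). Parallel arrows are therefore not
  representable, which is no restriction as only trees are considered.\<close>

record 'v quiver =
  sources :: "'v set"
  sinks :: "'v set"
  arrows :: "('v \<times> 'v) set"
  level :: "'v \<Rightarrow> nat"

definition verts :: "'v quiver \<Rightarrow> 'v set" where
  "verts Q = sources Q \<union> sinks Q"

definition bipartite_quiver :: "'v quiver \<Rightarrow> bool" where
  "bipartite_quiver Q \<longleftrightarrow>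
     finite (sources Q) \<and> finite (sinks Q) \<and> sources Q \<inter> sinks Q = {} \<and>
     arrows Q \<subseteq> sources Q \<times> sinks Q \<and> (\<forall>q\<in>verts Q. level Q q \<ge> 1)"

definition adjacent :: "'v quiver \<Rightarrow> 'v \<Rightarrow> 'v \<Rightarrow> bool" where
  "adjacent Q u v \<longleftrightarrow> (u, v) \<in> arrows Q \<or> (v, u) \<in> arrows Q"

definition neighbours :: "'v quiver \<Rightarrow> 'v \<Rightarrow> 'v set" where
  "neighbours Q q = {q'. adjacent Q q q'}"

text \<open>A tree in the undirected sense: connected and without cycles of length at least \<open>3\<close> in the
  underlying simple graph. (Acyclicity of the directed graph would be vacuous here, since all
  arrows go from sources to sinks.)\<close>

definition connected_quiver :: "'v quiver \<Rightarrow> bool" where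
  "connected_quiver Q \<longleftrightarrow> (\<forall>u\<in>verts Q. \<forall>v\<in>verts Q. (adjacent Q)\<^sup>*\<^sup>* u v)"

definition is_cycle :: "'v quiver \<Rightarrow> 'v list \<Rightarrow> bool" where
  "is_cycle Q vs \<longleftrightarrow>
     length vs \<ge> 3 \<and> distinct vs \<and>
     (\<forall>n<length vs. adjacent Q (vs ! n) (vs ! (Suc n mod length vs)))"

definition tree_quiver :: "'v quiver \<Rightarrow> bool" where
  "tree_quiver Q \<longleftrightarrow> verts Q \<noteq> {} \<and> connected_quiver Q \<and> (\<nexists>vs. is_cycle Q vs)"


section \<open>Representations over the complex numbers and stability\<close>

text \<open>The spaces of a representation are finite-dimensional subspaces of the complex vector space
  \<open>nat \<Rightarrow> complex\<close>, which contains a copy of every finite-dimensional complex vector space. The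
  maps are given on the whole ambient space; only their restrictions to the spaces of the
  representation matter, and every linear map between subspaces arises in this way.\<close>

definition cscale :: "complex \<Rightarrow> (nat \<Rightarrow> complex) \<Rightarrow> (nat \<Rightarrow> complex)" where
  "cscale c v = (\<lambda>n. c * v n)"

interpretation cvec: vector_space cscale
  by unfold_locales (auto simp: cscale_def fun_eq_iff algebra_simps)

record 'v rep =
  space :: "'v \<Rightarrow> (nat \<Rightarrow> complex) set"
  lmap :: "'v \<times> 'v \<Rightarrow> (nat \<Rightarrow> complex) \<Rightarrow> (nat \<Rightarrow> complex)"

definition representation :: "'v quiver \<Rightarrow> 'v rep \<Rightarrow> bool" where
  "representation Q X \<longleftrightarrow>
     (\<forall>q\<in>verts Q. cvec.subspace (space X q) \<and> (\<exists>B. finite B \<and> space X q = cvec.span B)) \<and>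
     (\<forall>(i, j)\<in>arrows Q. Vector_Spaces.linear cscale cscale (lmap X (i, j)) \<and>
                        lmap X (i, j) ` space X i \<subseteq> space X j)"

definition subrepresentation ::
    "'v quiver \<Rightarrow> 'v rep \<Rightarrow> ('v \<Rightarrow> (nat \<Rightarrow> complex) set) \<Rightarrow> bool" where
  "subrepresentation Q X U \<longleftrightarrow>
     (\<forall>q\<in>verts Q. cvec.subspace (U q) \<and> U q \<subseteq> space X q) \<and>
     (\<forall>(i, j)\<in>arrows Q. lmap X (i, j) ` U i \<subseteq> U j)"

definition dimvec :: "('v \<Rightarrow> (nat \<Rightarrow> complex) set) \<Rightarrow> 'v \<Rightarrow> nat" where
  "dimvec U q = cvec.dim (U q)"

definition slope :: "'v quiver \<Rightarrow> ('v \<Rightarrow> nat) \<Rightarrow> real" where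
  "slope Q e = real (\<Sum>i\<in>sources Q. level Q i * e i) / real (\<Sum>q\<in>verts Q. level Q q * e q)"

definition stable :: "'v quiver \<Rightarrow> 'v rep \<Rightarrow> bool" where
  "stable Q X \<longleftrightarrow>
     representation Q X \<and> (\<exists>q\<in>verts Q. space X q \<noteq> {0}) \<and>
     (\<forall>U. subrepresentation Q X U \<and> (\<exists>q\<in>verts Q. U q \<noteq> {0}) \<and> (\<exists>q\<in>verts Q. U q \<noteq> space X q)
          \<longrightarrow> slope Q (dimvec U) < slope Q (dimvec (space X)))"


section \<open>Uncoloured localization data\<close>

definition localization_data ::
    "(nat \<Rightarrow> nat) \<Rightarrow> (nat \<Rightarrow> nat) \<Rightarrow> 'v quiver \<Rightarrow> ('v \<Rightarrow> nat) \<Rightarrow> bool" where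
  "localization_data p p' Q d \<longleftrightarrow>
     bipartite_quiver Q \<and> tree_quiver Q \<and>
     (\<forall>l\<ge>1. card {i\<in>sources Q. level Q i = l} = p l \<and> card {j\<in>sinks Q. level Q j = l} = p' l) \<and>
     (\<forall>q\<in>verts Q. d q = 1) \<and>
     (\<exists>X. stable Q X \<and> (\<forall>q\<in>verts Q. dimvec (space X) q = d q))"

text \<open>Replace the source \<open>i\<close> by two sources \<open>i1\<close> and \<open>i2\<close> of levels \<open>1\<close> and \<open>level Q i - 1\<close> with
  neighbour sets \<open>J1\<close> and \<open>J2\<close>; \<open>i1\<close> and \<open>i2\<close> are meant to be distinct new vertices.\<close>

definition split_source :: "'v quiver \<Rightarrow> 'v \<Rightarrow> 'v \<Rightarrow> 'v \<Rightarrow> 'v set \<Rightarrow> 'v set \<Rightarrow> 'v quiver" where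
  "split_source Q i i1 i2 J1 J2 =
     \<lparr>sources = sources Q - {i} \<union> {i1, i2},
      sinks = sinks Q,
      arrows = {(u, v) \<in> arrows Q. u \<noteq> i} \<union> {i1} \<times> J1 \<union> {i2} \<times> J2,
      level = (level Q)(i1 := 1, i2 := level Q i - 1)\<rparr>"

end

theory Submission
  imports Defs
begin

text \<open>Let \<open>a\<close> and \<open>b\<close> be the total levels of the sources and of the sinks. A tree with dimension
  vector \<open>1\<close> admits a stable representation iff its arrows carry a positive flow with outflow
  \<open>b * level i\<close> at each source \<open>i\<close> and inflow \<open>a * level j\<close> at each sink \<open>j\<close>: the flow along an
  arrow is the stability defect of the branch behind it, and conversely such a flow bounds the slope
  of every subrepresentation. To split a source of level \<open>k\<close>, choose a maximal set of neighbours
  receiving a total flow less than \<open>b\<close> and let one further neighbour \<open>jt\<close> share its flow between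
  the two new sources. Both shares are positive unless some set of neighbours receives exactly \<open>b\<close>.
  In that case the branches behind it satisfy \<open>a * l(J) = b * (l(I) + 1)\<close> with \<open>l(J) \<le> b\<close> and
  \<open>l(I) \<le> a - k\<close>, which is impossible for coprime \<open>a\<close>, \<open>b\<close> and \<open>k \<ge> 2\<close>.\<close>

section \<open>Weighted partitions\<close>

text \<open>Written additively over \<open>int\<close>, the sequential updates become independent
  summands; for \<open>k = 2\<close> the last two simply both count at \<open>l = 1\<close>.\<close>

lemma split_part_eq:
  assumes "k \<ge> 2" "p k \<noteq> 0"
  shows "int (split_part k p l) =
    int (p l) - of_bool (l = k) + of_bool (l = k - 1) + of_bool (l = 1)"
  using assms by (auto simp: split_part_def Let_def)

lemma weighted_partition_sum:
  assumes "weighted_partition a p" "finite S" "{l. p l \<noteq> 0} \<subseteq> S"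
  shows "(\<Sum>l\<in>S. l * p l) = a"
proof -
  have "(\<Sum>l\<in>S. l * p l) = (\<Sum>l | p l \<noteq> 0. l * p l)"
    by (rule sum.mono_neutral_right) (use assms in auto)
  then show ?thesis using assms(1) by (simp add: weighted_partition_def)
qed

lemma weighted_partition_split_part:
  assumes wp: "weighted_partition a p" and k: "k \<ge> 2" "p k \<noteq> 0"
  shows "weighted_partition a (split_part k p)"
proof -
  define S where "S = {l. p l \<noteq> 0} \<union> {1, k - 1, k}"
  have fin: "finite S" using wp by (simp add: S_def weighted_partition_def)
  have sub: "{l. split_part k p l \<noteq> 0} \<subseteq> S"
    by (auto simp: S_def split_part_def Let_def split: if_splits)
  have zero: "split_part k p 0 = 0"
    using wp k by (auto simp: weighted_partition_def split_part_def Let_def)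
  have "int (\<Sum>l | split_part k p l \<noteq> 0. l * split_part k p l) = int (\<Sum>l\<in>S. l * split_part k p l)"
    by (intro arg_cong[of _ _ int] sum.mono_neutral_left) (use fin sub in auto)
  also have "\<dots> = (\<Sum>l\<in>S. int (l * p l) - of_bool (l = k) * int l
      + of_bool (l = k - 1) * int l + of_bool (l = 1) * int l)"
    unfolding of_nat_sum
    by (intro sum.cong refl) (simp add: split_part_eq[of k p, OF k] algebra_simps)
  also have "\<dots> = int (\<Sum>l\<in>S. l * p l) - int k + int (k - 1) + 1"
    using fin k by (simp add: sum.distrib sum_subtractf of_bool_def if_distrib[of "\<lambda>c. c * _"]
        S_def cong: if_cong)
  also have "(\<Sum>l\<in>S. l * p l) = a"
    by (rule weighted_partition_sum[OF wp fin]) (auto simp: S_def)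
  finally have "int (\<Sum>l | split_part k p l \<noteq> 0. l * split_part k p l) = int a"
    using k by (simp add: of_nat_diff)
  then show ?thesis
    using zero finite_subset[OF sub fin] by (simp only: weighted_partition_def of_nat_eq_iff)
qed

text \<open>Group the vertices of \<open>S\<close> by level. The counting hypothesis is silent about
  level \<open>0\<close>, but \<open>p 0 = 0\<close> and positive levels keep \<open>0\<close> out
  of \<open>T\<close>.\<close>

lemma sum_level_eq:
  fixes lev :: "'v \<Rightarrow> nat"
  assumes "finite S" "weighted_partition a p" "\<forall>l\<ge>1. card {i\<in>S. lev i = l} = p l"
    and "\<forall>i\<in>S. lev i \<ge> 1"
  shows "(\<Sum>i\<in>S. lev i) = a"
proof -
  define T where "T = {l. p l \<noteq> 0} \<union> lev ` S"
  have fin: "finite T" using assms by (simp add: T_def weighted_partition_def)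
  have "(\<Sum>i\<in>S. lev i) = (\<Sum>l\<in>T. \<Sum>i | i \<in> S \<and> lev i = l. lev i)"
    by (rule sum.group[symmetric]) (use assms(1) fin in \<open>auto simp: T_def\<close>)
  also have "\<dots> = (\<Sum>l\<in>T. l * p l)"
  proof (rule sum.cong)
    fix l assume "l \<in> T"
    then have "l \<ge> 1"
      using assms(2,4) by (cases l) (auto simp: T_def weighted_partition_def)
    then show "(\<Sum>i | i \<in> S \<and> lev i = l. lev i) = l * p l"
      using assms(3) by simp
  qed simp
  also have "\<dots> = a"
    by (rule weighted_partition_sum[OF assms(2) fin]) (auto simp: T_def)
  finally show ?thesis .
qed


section \<open>Branches of a tree\<close>

text \<open>The path is built from its end. If the new first vertex already occurs, a loop has
  closed, and only the suffix from that occurrence is kept.\<close>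

lemma rtranclp_distinct_path:
  assumes "r\<^sup>*\<^sup>* x y"
  shows "\<exists>vs. vs \<noteq> [] \<and> hd vs = x \<and> last vs = y \<and> distinct vs \<and> successively r vs"
  using assms
proof (induction rule: converse_rtranclp_induct)
  case base
  show ?case by (rule exI[of _ "[y]"]) simp
next
  case (step x z)
  then obtain vs where vs: "vs \<noteq> []" "hd vs = z" "last vs = y" "distinct vs" "successively r vs"
    by blast
  show ?case
  proof (cases "x \<in> set vs")
    case True
    then obtain ys zs where "vs = ys @ x # zs" by (auto simp: in_set_conv_decomp)
    with vs show ?thesis
      by (intro exI[of _ "x # zs"]) (auto simp: successively_append_iff)
  next
    case False
    with vs step(1) show ?thesis
      by (intro exI[of _ "x # vs"]) (auto simp: successively_Cons)
  qed
qed

text \<open>\<open>e\<close> is an unordered pair, so that an edge is deleted in both directions at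
  once.\<close>

definition adjacent_off :: "'v quiver \<Rightarrow> 'v set \<Rightarrow> 'v \<Rightarrow> 'v \<Rightarrow> bool" where
  "adjacent_off Q e x y \<longleftrightarrow> adjacent Q x y \<and> {x, y} \<noteq> e"

text \<open>For adjacent \<open>v\<close> and \<open>w\<close> in a tree, this is the component of
  \<open>w\<close> after deleting the edge \<open>{v, w}\<close>: the part lying beyond
  \<open>w\<close> as seen from \<open>v\<close>.\<close>

definition branch :: "'v quiver \<Rightarrow> 'v \<Rightarrow> 'v \<Rightarrow> 'v set" where
  "branch Q v w = {u. (adjacent_off Q {v, w})\<^sup>*\<^sup>* w u}"

lemma adjacent_sym: "adjacent Q u v \<longleftrightarrow> adjacent Q v u"
  by (auto simp: adjacent_def)

lemma adjacent_off_rtranclp_sym: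
  assumes "(adjacent_off Q e)\<^sup>*\<^sup>* u v"
  shows "(adjacent_off Q e)\<^sup>*\<^sup>* v u"
proof -
  have "symp (adjacent_off Q e)"
    by (rule sympI) (auto simp: adjacent_off_def adjacent_def insert_commute)
  then have "symp ((adjacent_off Q e)\<^sup>*\<^sup>*)" by (rule symp_rtranclp)
  with assms show ?thesis by (rule sympD[rotated])
qed

lemma branch_self: "w \<in> branch Q v w"
  by (simp add: branch_def)

lemma branch_step:
  assumes "u \<in> branch Q v w" "adjacent Q u z" "{u, z} \<noteq> {v, w}"
  shows "z \<in> branch Q v w"
proof -
  have "adjacent_off Q {v, w} u z" using assms(2,3) by (simp add: adjacent_off_def)
  with assms(1) show ?thesis unfolding branch_def by (auto intro: rtranclp.rtrancl_into_rtrancl)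
qed

locale tree =
  fixes Q :: "'v quiver"
  assumes bip: "bipartite_quiver Q" and tree: "tree_quiver Q"
begin

lemma finite_sources: "finite (sources Q)" and finite_sinks: "finite (sinks Q)"
  and disjoint: "sources Q \<inter> sinks Q = {}"
  and finite_verts: "finite (verts Q)"
  using bip by (auto simp: bipartite_quiver_def verts_def)

lemma arrowD:
  assumes "(i, j) \<in> arrows Q"
  shows "i \<in> sources Q" "j \<in> sinks Q" "i \<in> verts Q" "j \<in> verts Q" "i \<noteq> j"
  using assms bip by (auto simp: bipartite_quiver_def verts_def)

lemma adjacentD:
  assumes "adjacent Q u v"
  shows "u \<in> verts Q" "v \<in> verts Q" "u \<noteq> v"
  using assms by (auto simp: adjacent_def dest: arrowD)

lemma neighbours_source: "i \<in> sources Q \<Longrightarrow> neighbours Q i = {j \<in> sinks Q. (i, j) \<in> arrows Q}"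
  using disjoint by (auto simp: neighbours_def adjacent_def disjoint_iff dest: arrowD(1,2))

lemma neighbours_sink: "j \<in> sinks Q \<Longrightarrow> neighbours Q j = {i \<in> sources Q. (i, j) \<in> arrows Q}"
  using disjoint by (auto simp: neighbours_def adjacent_def disjoint_iff dest: arrowD(1,2))

lemma finite_neighbours: "finite (neighbours Q v)"
  by (rule finite_subset[OF _ finite_verts]) (auto simp: neighbours_def adjacentD)

text \<open>A path from \<open>w\<close> to \<open>v\<close> avoiding the edge between them would
  close up with that edge to a cycle.\<close>

lemma not_in_branch:
  assumes adj: "adjacent Q v w"
  shows "v \<notin> branch Q v w"
proof
  assume "v \<in> branch Q v w"
  then obtain vs where vs: "vs \<noteq> []" "hd vs = w" "last vs = v" "distinct vs"
      "successively (adjacent_off Q {v, w}) vs"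
    using rtranclp_distinct_path[of "adjacent_off Q {v, w}" w v] by (auto simp: branch_def)
  have "v \<noteq> w" using adjacentD[OF adj] by simp
  \<comment> \<open>A single vertex would mean \<open>v = w\<close>, and two vertices would use the
    deleted edge.\<close>
  have len: "length vs \<ge> 3"
  proof (rule ccontr)
    assume "\<not> length vs \<ge> 3"
    moreover have "length vs > 0" using vs(1) by simp
    ultimately consider "length vs = 1" | "length vs = 2" by linarith
    then show False
    proof cases
      case 1
      with vs \<open>v \<noteq> w\<close> show False by (auto simp: length_Suc_conv)
    next
      case 2
      with vs show False
        by (auto simp: length_Suc_conv numeral_2_eq_2 adjacent_off_def insert_commute)
    qed
  qed
  have "is_cycle Q vs" unfolding is_cycle_def
  proof (intro conjI allI impI len vs(4))
    fix n assume n: "n < length vs"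
    show "adjacent Q (vs ! n) (vs ! (Suc n mod length vs))"
    proof (cases "Suc n < length vs")
      case True
      then have "adjacent_off Q {v, w} (vs ! n) (vs ! Suc n)"
        using vs(5) by (simp add: successively_conv_nth)
      with True show ?thesis by (simp add: adjacent_off_def)
    next
      case False
      with n have "n = length vs - 1" "Suc n mod length vs = 0"
        by (simp_all add: Suc_lessI not_less_eq less_Suc_eq)
      with vs(1-3) adj show ?thesis by (simp add: last_conv_nth hd_conv_nth)
    qed
  qed
  with tree show False by (simp add: tree_quiver_def)
qed

lemma branch_subset:
  assumes "adjacent Q v w"
  shows "branch Q v w \<subseteq> verts Q"
proof
  fix u assume "u \<in> branch Q v w"
  then have "(adjacent_off Q {v, w})\<^sup>*\<^sup>* w u" by (simp add: branch_def)
  then show "u \<in> verts Q"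
    by (cases rule: rtranclp.cases) (use adjacentD assms in \<open>auto simp: adjacent_off_def\<close>)
qed

text \<open>The arrow survives the deletion of \<open>{v, w}\<close>, so each of its ends is
  reachable from the other. Thus a branch is a cut crossed by one edge only.\<close>

lemma branch_arrow_iff:
  assumes "adjacent Q v w" "(x, y) \<in> arrows Q" "{x, y} \<noteq> {v, w}"
  shows "x \<in> branch Q v w \<longleftrightarrow> y \<in> branch Q v w"
  using branch_step[of x Q v w y] branch_step[of y Q v w x] assms
  by (auto simp: adjacent_def insert_commute)

text \<open>Follow a path from \<open>v\<close>: each departure from \<open>v\<close> selects a
  branch, which can be left only by returning to \<open>v\<close>.\<close>

lemma Union_branch:
  assumes v: "v \<in> verts Q"
  shows "verts Q - {v} = (\<Union>w\<in>neighbours Q v. branch Q v w)"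
proof (intro subset_antisym subsetI)
  fix u assume "u \<in> verts Q - {v}"
  with v tree have "(adjacent Q)\<^sup>*\<^sup>* v u"
    by (auto simp: tree_quiver_def connected_quiver_def)
  then have "u = v \<or> (\<exists>w\<in>neighbours Q v. u \<in> branch Q v w)"
  proof (induction rule: rtranclp_induct)
    case (step u z)
    from step(3) show ?case
    proof
      assume "u = v"
      with step(2) show ?thesis by (auto simp: neighbours_def branch_self)
    next
      assume "\<exists>w\<in>neighbours Q v. u \<in> branch Q v w"
      then obtain w where w: "adjacent Q v w" "u \<in> branch Q v w" by (auto simp: neighbours_def)
      then have "u \<noteq> v" using not_in_branch by auto
      then have "z \<in> branch Q v w" if "z \<noteq> v"
        using branch_step[OF w(2) step(2)] that by auto
      with w(1) show ?thesis by (auto simp: neighbours_def)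
    qed
  qed simp
  with \<open>u \<in> verts Q - {v}\<close> show "u \<in> (\<Union>w\<in>neighbours Q v. branch Q v w)" by auto
next
  fix u assume "u \<in> (\<Union>w\<in>neighbours Q v. branch Q v w)"
  then obtain w where w: "adjacent Q v w" "u \<in> branch Q v w" by (auto simp: neighbours_def)
  then show "u \<in> verts Q - {v}" using branch_subset[OF w(1)] not_in_branch[OF w(1)] by auto
qed

text \<open>A path inside the branch at \<open>w'\<close> never visits \<open>v\<close>, hence also
  avoids the edge \<open>{v, w}\<close>. A common vertex would therefore put \<open>w'\<close>, and
  then its neighbour \<open>v\<close>, into the branch at \<open>w\<close>.\<close>

lemma disjoint_branches:
  assumes w: "adjacent Q v w" and w': "adjacent Q v w'" and "w \<noteq> w'"
  shows "branch Q v w \<inter> branch Q v w' = {}"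
proof (rule ccontr)
  assume "branch Q v w \<inter> branch Q v w' \<noteq> {}"
  then obtain u where u: "u \<in> branch Q v w" "u \<in> branch Q v w'" by blast
  from u(2) have "(adjacent_off Q {v, w'})\<^sup>*\<^sup>* w' u" by (simp add: branch_def)
  then have "(adjacent_off Q {v, w})\<^sup>*\<^sup>* w' u"
  proof (induction rule: rtranclp_induct)
    case (step y z)
    have "y \<in> branch Q v w'" "z \<in> branch Q v w'"
      using step(1,2) by (auto simp: branch_def)
    then have "y \<noteq> v" "z \<noteq> v" using not_in_branch[OF w'] by auto
    with step(2) have "adjacent_off Q {v, w} y z" by (simp add: adjacent_off_def doubleton_eq_iff)
    with step(3) show ?case by simp
  qed simp
  from adjacent_off_rtranclp_sym[OF this] u(1) have "w' \<in> branch Q v w"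
    by (auto simp: branch_def)
  then have "v \<in> branch Q v w"
    by (rule branch_step) (use w' \<open>w \<noteq> w'\<close> adjacentD[OF w'] in \<open>auto simp: adjacent_def doubleton_eq_iff\<close>)
  with not_in_branch[OF w] show False by simp
qed

text \<open>A vertex on both sides of the edge would link \<open>w\<close> to \<open>v\<close>
  without it. Conversely, a path from \<open>v\<close> changes sides only by crossing the edge, and
  then stands at one of its ends.\<close>

lemma branch_opposite:
  assumes vw: "adjacent Q v w"
  shows "branch Q w v = verts Q - branch Q v w"
proof (intro subset_antisym subsetI)
  fix u assume u: "u \<in> branch Q w v"
  have "u \<notin> branch Q v w"
  proof
    assume "u \<in> branch Q v w"
    moreover have "(adjacent_off Q {v, w})\<^sup>*\<^sup>* u v"
      using u by (auto simp: branch_def insert_commute intro: adjacent_off_rtranclp_sym)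
    ultimately have "v \<in> branch Q v w" by (auto simp: branch_def)
    with not_in_branch[OF vw] show False ..
  qed
  moreover have "u \<in> verts Q" using u branch_subset[of w v] vw adjacent_sym[of Q v w] by auto
  ultimately show "u \<in> verts Q - branch Q v w" by simp
next
  fix u assume u: "u \<in> verts Q - branch Q v w"
  then have "(adjacent Q)\<^sup>*\<^sup>* v u"
    using tree adjacentD[OF vw] by (auto simp: tree_quiver_def connected_quiver_def)
  then have "u \<in> branch Q v w \<union> branch Q w v"
  proof (induction rule: rtranclp_induct)
    case (step y z)
    show ?case
    proof (cases "{y, z} = {v, w}")
      case True
      then have "z = v \<or> z = w" by auto
      then show ?thesis using branch_self by fast
    next
      case False
      then have "{y, z} \<noteq> {w, v}" by (simp add: insert_commute)
      with False step show ?thesis using branch_step[of y Q _ _ z] by blast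
    qed
  qed (simp add: branch_self)
  with u show "u \<in> branch Q w v" by simp
qed

lemma sum_branches:
  fixes f :: "'v \<Rightarrow> int"
  assumes "S \<subseteq> neighbours Q v"
  shows "sum f (\<Union>w\<in>S. branch Q v w) = (\<Sum>w\<in>S. sum f (branch Q v w))"
  using assms finite_neighbours finite_verts
  by (intro sum.UNION_disjoint ballI impI disjoint_branches)
     (auto simp: neighbours_def intro: finite_subset[OF branch_subset] finite_subset)

end

text \<open>The rest of a cycle joins the two ends of any of its arrows without using that arrow, so
  it cannot cross a cut that is crossed by this arrow alone.\<close>

lemma no_cycleI:
  assumes cut: "\<And>u v. (u, v) \<in> arrows Q \<Longrightarrow>
    \<exists>A. (u \<in> A) \<noteq> (v \<in> A) \<and> (\<forall>(x, y)\<in>arrows Q - {(u, v)}. x \<in> A \<longleftrightarrow> y \<in> A)"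
    and loop: "\<And>u v. (u, v) \<in> arrows Q \<Longrightarrow> (v, u) \<notin> arrows Q"
  shows "\<not> is_cycle Q vs"
proof
  assume "is_cycle Q vs"
  then have len: "length vs \<ge> 3" and dist: "distinct vs"
    and adj: "\<And>n. n < length vs \<Longrightarrow> adjacent Q (vs ! n) (vs ! (Suc n mod length vs))"
    by (auto simp: is_cycle_def)
  have "vs \<noteq> []" using len by auto
  then have "adjacent Q (vs ! 0) (vs ! 1)" using adj[of 0] len by simp
  then obtain u v where uv: "(u, v) \<in> arrows Q" "{u, v} = {vs ! 0, vs ! 1}"
    by (auto simp: adjacent_def)
  from cut[OF uv(1)] obtain A where A: "(u \<in> A) \<noteq> (v \<in> A)"
    "\<forall>(x, y)\<in>arrows Q - {(u, v)}. x \<in> A \<longleftrightarrow> y \<in> A" by (elim exE conjE)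
  then have same: "x \<in> A \<longleftrightarrow> y \<in> A" if "(x, y) \<in> arrows Q" "(x, y) \<noteq> (u, v)" for x y
    using that by auto
  \<comment> \<open>The edge from position \<open>0\<close> to position \<open>1\<close> is the
    arrow \<open>(u, v)\<close>. All other edges of the cycle, including the closing one, start at a
    position \<open>n >= 1\<close> and stay on one side of \<open>A\<close>.\<close>
  have side: "vs ! n \<in> A \<longleftrightarrow> vs ! (Suc n mod length vs) \<in> A" if n: "1 \<le> n" "n < length vs" for n
  proof -
    define m where "m = Suc n mod length vs"
    \<comment> \<open>With length at least \<open>3\<close>, the closing edge back to position
      \<open>0\<close> cannot start at position \<open>1\<close>, so it differs from the first
      edge.\<close>
    have m: "m < length vs" "m \<noteq> n" "m = 0 \<or> m = Suc n" "m = 0 \<Longrightarrow> n \<noteq> 1"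
      using n len by (auto simp: m_def mod_Suc)
    have "{vs ! n, vs ! m} \<noteq> {vs ! 0, vs ! 1}"
    proof
      assume "{vs ! n, vs ! m} = {vs ! 0, vs ! 1}"
      then have "(vs ! n = vs ! 0 \<or> vs ! n = vs ! 1) \<and> (vs ! m = vs ! 0 \<or> vs ! m = vs ! 1)"
        by auto
      moreover have "vs \<noteq> []" "1 < length vs" using len by auto
      ultimately have "(n = 0 \<or> n = 1) \<and> (m = 0 \<or> m = 1)"
        using n m len dist by (auto simp: nth_eq_iff_index_eq)
      with m n show False by auto
    qed
    with uv(2) have ne: "{vs ! n, vs ! m} \<noteq> {u, v}" by simp
    have "adjacent Q (vs ! n) (vs ! m)" using adj n by (simp add: m_def)
    with ne same[of "vs ! n" "vs ! m"] same[of "vs ! m" "vs ! n"] show ?thesis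
      by (auto simp: adjacent_def m_def insert_commute)
  qed
  have "vs ! 1 \<in> A \<longleftrightarrow> vs ! n \<in> A" if "1 \<le> n" "n < length vs" for n
    using that
  proof (induction n rule: dec_induct)
    case (step n)
    then show ?case using side[of n] by simp
  qed simp
  moreover have last: "1 \<le> length vs - 1" "length vs - 1 < length vs" "Suc (length vs - 1) = length vs"
    using len by auto
  ultimately have "vs ! 1 \<in> A \<longleftrightarrow> vs ! (length vs - 1) \<in> A" by blast
  also have "\<dots> \<longleftrightarrow> vs ! 0 \<in> A" using side[OF last(1,2)] unfolding last(3) by simp
  finally have "vs ! 1 \<in> A \<longleftrightarrow> vs ! 0 \<in> A" .
  with A(1) uv(2) show False by (auto simp: doubleton_eq_iff)
qed


section \<open>Stability and flows\<close>

text \<open>For the indicator of \<open>A\<close> the slopes are \<open>s / (s + t)\<close> and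
  \<open>a / (a + b)\<close>; after clearing the positive denominators, \<open>a * s\<close> cancels
  on both sides.\<close>

lemma slope_less_iff:
  assumes bip: "bipartite_quiver Q" and A: "A \<subseteq> verts Q" "A \<noteq> {}"
    and e: "\<And>q. q \<in> verts Q \<Longrightarrow> e q = of_bool (q \<in> A)"
    and e': "\<And>q. q \<in> verts Q \<Longrightarrow> e' q = 1"
    and a: "(\<Sum>i\<in>sources Q. level Q i) = a" and b: "(\<Sum>j\<in>sinks Q. level Q j) = b"
  shows "slope Q e < slope Q e' \<longleftrightarrow>
    b * (\<Sum>i\<in>sources Q \<inter> A. level Q i) < a * (\<Sum>j\<in>sinks Q \<inter> A. level Q j)"
proof -
  define s where "s = (\<Sum>i\<in>sources Q \<inter> A. level Q i)"
  define t where "t = (\<Sum>j\<in>sinks Q \<inter> A. level Q j)"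
  have fin: "finite (sources Q)" "finite (sinks Q)" and dis: "sources Q \<inter> sinks Q = {}"
    using bip by (auto simp: bipartite_quiver_def)
  have restrict: "(\<Sum>q\<in>S. level Q q * e q) = (\<Sum>q\<in>S \<inter> A. level Q q)"
    if "finite S" "S \<subseteq> verts Q" for S
    using that by (simp add: sum.inter_restrict e subset_iff of_bool_def if_distrib cong: if_cong sum.cong)
  have all: "(\<Sum>q\<in>S. level Q q * e' q) = (\<Sum>q\<in>S. level Q q)" if "S \<subseteq> verts Q" for S
    using that by (intro sum.cong) (auto simp: e')
  have src: "(\<Sum>i\<in>sources Q. level Q i * e i) = s" "(\<Sum>i\<in>sources Q. level Q i * e' i) = a"
    using restrict[of "sources Q"] all[of "sources Q"] fin a by (auto simp: s_def verts_def)
  have snk: "(\<Sum>i\<in>sinks Q. level Q i * e i) = t" "(\<Sum>i\<in>sinks Q. level Q i * e' i) = b"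
    using restrict[of "sinks Q"] all[of "sinks Q"] fin b by (auto simp: t_def verts_def)
  have slopes: "slope Q e = real s / real (s + t)" "slope Q e' = real a / real (a + b)"
    using fin dis by (simp_all add: slope_def verts_def sum.union_disjoint src snk)
  have st: "s + t = (\<Sum>q\<in>A. level Q q)"
  proof -
    have "A = (sources Q \<inter> A) \<union> (sinks Q \<inter> A)" using A by (auto simp: verts_def)
    then have "(\<Sum>q\<in>A. level Q q) = (\<Sum>q\<in>(sources Q \<inter> A) \<union> (sinks Q \<inter> A). level Q q)" by simp
    also have "\<dots> = s + t" unfolding s_def t_def
      by (rule sum.union_disjoint) (use fin dis in auto)
    finally show ?thesis ..
  qed
  have finA: "finite A" using A(1) fin by (auto simp: verts_def intro: finite_subset)
  obtain q where q: "q \<in> A" using A(2) by blast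
  have "0 < level Q q" using q A(1) bip by (force simp: bipartite_quiver_def)
  also have "level Q q \<le> s + t" unfolding st using q finA by (intro member_le_sum) auto
  finally have pos: "0 < s + t" .
  have "s \<le> a" "t \<le> b" unfolding s_def t_def a[symmetric] b[symmetric]
    using fin by (auto intro!: sum_mono2)
  with pos have pos': "0 < a + b" by linarith
  have "slope Q e < slope Q e' \<longleftrightarrow> real s * real (a + b) < real a * real (s + t)"
  proof -
    have "0 < real (s + t)" "0 < real (a + b)"
      unfolding of_nat_0_less_iff using pos pos' by simp_all
    then show ?thesis
      unfolding slopes
      by (simp add: pos_divide_less_eq pos_less_divide_eq del: of_nat_add)
  qed
  also have "\<dots> \<longleftrightarrow> b * s < a * t"
    unfolding of_nat_mult[symmetric] of_nat_less_iff by (auto simp: algebra_simps)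
  finally show ?thesis by (simp add: s_def t_def)
qed

lemma dim_zero: "cvec.dim {0} = 0"
  using cvec.dim_span[of "{}"] cvec.dim_eq_card_independent[OF cvec.independent_empty]
  by (simp add: cvec.span_empty)

text \<open>The value \<open>0\<close> off the arrows lets the sums run over fixed sets. When the
  total levels are \<open>a\<close> and \<open>b\<close>, supply and demand both equal
  \<open>a * b\<close>.\<close>

definition positive_flow :: "'v quiver \<Rightarrow> nat \<Rightarrow> nat \<Rightarrow> ('v \<Rightarrow> 'v \<Rightarrow> int) \<Rightarrow> bool" where
  "positive_flow Q a b x \<longleftrightarrow>
     (\<forall>i\<in>sources Q. \<forall>j\<in>sinks Q. if (i, j) \<in> arrows Q then x i j > 0 else x i j = 0) \<and>
     (\<forall>i\<in>sources Q. (\<Sum>j\<in>sinks Q. x i j) = int (b * level Q i)) \<and>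
     (\<forall>j\<in>sinks Q. (\<Sum>i\<in>sources Q. x i j) = int (a * level Q j))"

text \<open>Take a line at every vertex and the identity along every arrow. A subrepresentation is
  then determined by its support \<open>A\<close>, which is closed under arrows: all flow from
  sources in \<open>A\<close> ends in \<open>A\<close>, and some flow enters \<open>A\<close> from
  outside.\<close>

lemma flow_imp_stable:
  assumes bip: "bipartite_quiver Q" and conn: "connected_quiver Q" and ne: "verts Q \<noteq> {}"
    and a: "(\<Sum>i\<in>sources Q. level Q i) = a" and b: "(\<Sum>j\<in>sinks Q. level Q j) = b"
    and flow: "positive_flow Q a b x"
  shows "\<exists>X. stable Q X \<and> (\<forall>q\<in>verts Q. dimvec (space X) q = 1)"
proof -
  \<comment> \<open>Any nonzero vector would serve to span the common line.\<close>
  define e :: "nat \<Rightarrow> complex" where "e = (\<lambda>_. 1)"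
  define X :: "'a rep" where "X = \<lparr>space = \<lambda>_. cvec.span {e}, lmap = \<lambda>_. id\<rparr>"
  have e0: "e \<noteq> 0" by (simp add: e_def fun_eq_iff)
  have dim1: "cvec.dim (cvec.span {e}) = 1"
    using e0 cvec.dim_eq_card_independent[of "{e}"] by simp
  have rep: "representation Q X"
    unfolding representation_def X_def
    by (auto simp: cvec.subspace_span cvec.linear_id)
  have fin: "finite (sources Q)" "finite (sinks Q)"
    using bip by (auto simp: bipartite_quiver_def)
  have "slope Q (dimvec U) < slope Q (dimvec (space X))"
    if U: "subrepresentation Q X U" and ne0: "\<exists>q\<in>verts Q. U q \<noteq> {0}"
      and proper: "\<exists>q\<in>verts Q. U q \<noteq> space X q" for U
  proof -
    define A where "A = {q \<in> verts Q. U q \<noteq> {0}}"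
    have sub: "cvec.subspace (U q)" "U q \<subseteq> cvec.span {e}" if "q \<in> verts Q" for q
      using U that by (auto simp: subrepresentation_def X_def)
    have full: "U q = cvec.span {e}" if "q \<in> A" for q
    proof -
      have q: "q \<in> verts Q" "U q \<noteq> {0}" using that by (auto simp: A_def)
      then obtain u where u: "u \<in> U q" "u \<noteq> 0" using cvec.subspace_0[OF sub(1)] by blast
      then obtain c where c: "u = cscale c e" using sub(2)[OF q(1)] by (auto simp: cvec.span_singleton)
      with u have "c \<noteq> 0" by auto
      then have "e = cscale (inverse c) u" by (simp add: c cvec.scale_scale)
      then have "e \<in> U q" using cvec.subspace_scale[OF sub(1)[OF q(1)] u(1)] by simp
      then have "cvec.span {e} \<subseteq> U q" by (intro cvec.span_minimal sub(1) q) auto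
      with sub(2)[OF q(1)] show ?thesis by auto
    qed
    have closed: "j \<in> A" if "(i, j) \<in> arrows Q" "i \<in> A" for i j
    proof -
      have "U i \<subseteq> U j" using U that(1) by (force simp: subrepresentation_def X_def)
      moreover have "e \<in> U i" using full[OF that(2)] cvec.span_base[of e "{e}"] by simp
      moreover have "j \<in> verts Q" using that(1) bip by (auto simp: bipartite_quiver_def verts_def)
      ultimately show ?thesis using e0 by (auto simp: A_def)
    qed
    \<comment> \<open>Without an arrow entering it, the closed set \<open>A\<close> would be stable
      under adjacency, hence everything by connectedness.\<close>
    have "\<exists>i j. (i, j) \<in> arrows Q \<and> i \<notin> A \<and> j \<in> A"
    proof (rule ccontr)
      assume no: "\<nexists>i j. (i, j) \<in> arrows Q \<and> i \<notin> A \<and> j \<in> A"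
      obtain u where u: "u \<in> verts Q" "u \<in> A" using ne0 by (auto simp: A_def)
      obtain v where v: "v \<in> verts Q" "U v \<noteq> cvec.span {e}" using proper by (auto simp: X_def)
      then have "v \<notin> A" using full by auto
      have "(adjacent Q)\<^sup>*\<^sup>* u v" using conn u(1) v(1) by (simp add: connected_quiver_def)
      then have "v \<in> A"
        by (induction rule: rtranclp_induct)
           (use u no closed in \<open>auto simp: adjacent_def\<close>)
      with \<open>v \<notin> A\<close> show False ..
    qed
    then obtain i0 j0 where ij: "(i0, j0) \<in> arrows Q" "i0 \<notin> A" "j0 \<in> A" by blast
    then have ij': "i0 \<in> sources Q" "j0 \<in> sinks Q"
      using bip by (auto simp: bipartite_quiver_def)
    have arr: "(i, j) \<in> arrows Q \<Longrightarrow> x i j > 0" "(i, j) \<notin> arrows Q \<Longrightarrow> x i j = 0"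
      if "i \<in> sources Q" "j \<in> sinks Q" for i j
      using flow that by (auto simp: positive_flow_def)
    then have nonneg: "x i j \<ge> 0" if "i \<in> sources Q" "j \<in> sinks Q" for i j
      using that by (cases "(i, j) \<in> arrows Q") (auto intro: less_imp_le)
    have "int (b * (\<Sum>i\<in>sources Q \<inter> A. level Q i)) = (\<Sum>i\<in>sources Q \<inter> A. \<Sum>j\<in>sinks Q. x i j)"
      using flow by (auto simp: positive_flow_def sum_distrib_left intro!: sum.cong)
    \<comment> \<open>Closedness of \<open>A\<close> leaves no arrow from a source in
      \<open>A\<close> to a sink outside.\<close>
    also have "\<dots> = (\<Sum>i\<in>sources Q \<inter> A. \<Sum>j\<in>sinks Q \<inter> A. x i j)"
      by (intro sum.cong refl sum.mono_neutral_right) (use fin closed arr in blast)+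
    also have "\<dots> = (\<Sum>j\<in>sinks Q \<inter> A. \<Sum>i\<in>sources Q \<inter> A. x i j)" by (rule sum.swap)
    \<comment> \<open>The inequality is strict at \<open>j0\<close>, which also receives
      \<open>x i0 j0 > 0\<close> from outside \<open>A\<close>.\<close>
    also have "\<dots> < (\<Sum>j\<in>sinks Q \<inter> A. \<Sum>i\<in>sources Q. x i j)"
    proof (rule sum_strict_mono_ex1)
      show "\<forall>j\<in>sinks Q \<inter> A. (\<Sum>i\<in>sources Q \<inter> A. x i j) \<le> (\<Sum>i\<in>sources Q. x i j)"
        using fin nonneg by (auto intro!: sum_mono2)
      have "(\<Sum>i\<in>sources Q \<inter> A. x i j0) < (\<Sum>i\<in>sources Q. x i j0)"
        by (rule sum_strict_mono2[of _ _ i0]) (use fin nonneg arr ij ij' in auto)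
      then show "\<exists>j\<in>sinks Q \<inter> A. (\<Sum>i\<in>sources Q \<inter> A. x i j) < (\<Sum>i\<in>sources Q. x i j)"
        using ij ij' by auto
    qed (use fin in simp)
    also have "\<dots> = int (a * (\<Sum>j\<in>sinks Q \<inter> A. level Q j))"
      using flow by (auto simp: positive_flow_def sum_distrib_left intro!: sum.cong)
    finally have less: "b * (\<Sum>i\<in>sources Q \<inter> A. level Q i) < a * (\<Sum>j\<in>sinks Q \<inter> A. level Q j)"
      by (simp only: of_nat_less_iff)
    show ?thesis
    proof (rule slope_less_iff[OF bip _ _ _ _ a b, THEN iffD2, OF _ _ _ _ less])
      show "A \<subseteq> verts Q" "A \<noteq> {}" using ij by (auto simp: A_def)
      show "dimvec U q = of_bool (q \<in> A)" if "q \<in> verts Q" for q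
      proof (cases "q \<in> A")
        case True
        then show ?thesis using full dim1 by (simp add: dimvec_def)
      next
        case False
        then have "U q = {0}" using that by (simp add: A_def)
        with False show ?thesis by (simp add: dimvec_def dim_zero)
      qed
      show "dimvec (space X) q = 1" for q
        using dim1 by (simp add: dimvec_def X_def)
    qed
  qed
  moreover have "\<exists>q\<in>verts Q. space X q \<noteq> {0}"
    using ne e0 cvec.span_base[of e "{e}"] by (auto simp: X_def)
  ultimately have "stable Q X" using rep by (simp add: stable_def)
  then show ?thesis
    using dim1 by (auto simp: dimvec_def X_def)
qed

section \<open>From stability to a positive flow: defects of branches\<close>

definition defect :: "'v quiver \<Rightarrow> nat \<Rightarrow> nat \<Rightarrow> 'v \<Rightarrow> int" where
  "defect Q a b q = (if q \<in> sources Q then int (b * level Q q) else - int (a * level Q q))"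

context tree
begin

text \<open>The two terms are the sides of the inequality in \<open>slope_less_iff\<close>, so for
  nonempty \<open>A\<close> a negative defect means that the indicator of \<open>A\<close> has the
  smaller slope.\<close>

lemma sum_defect:
  assumes "A \<subseteq> verts Q"
  shows "sum (defect Q a b) A =
    int (b * (\<Sum>i\<in>sources Q \<inter> A. level Q i)) - int (a * (\<Sum>j\<in>sinks Q \<inter> A. level Q j))"
proof -
  have "A = (sources Q \<inter> A) \<union> (sinks Q \<inter> A)" using assms by (auto simp: verts_def)
  then have "sum (defect Q a b) A = sum (defect Q a b) ((sources Q \<inter> A) \<union> (sinks Q \<inter> A))" by simp
  also have "\<dots> = sum (defect Q a b) (sources Q \<inter> A) + sum (defect Q a b) (sinks Q \<inter> A)"
    by (rule sum.union_disjoint) (use finite_sources finite_sinks disjoint in auto)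
  also have "sum (defect Q a b) (sources Q \<inter> A) = int (b * (\<Sum>i\<in>sources Q \<inter> A. level Q i))"
    by (auto simp: defect_def sum_distrib_left intro!: sum.cong)
  also have "sum (defect Q a b) (sinks Q \<inter> A) = - int (a * (\<Sum>j\<in>sinks Q \<inter> A. level Q j))"
    using disjoint by (auto simp: defect_def sum_distrib_left sum_negf[symmetric] intro!: sum.cong)
  finally show ?thesis by simp
qed

text \<open>The only arrow between the branch and its complement is \<open>(i, j)\<close>, and it
  points into the branch. So \<open>X\<close> cut down to the branch is a proper nonzero
  subrepresentation, to which stability applies.\<close>

lemma stable_imp_defect_neg:
  assumes st: "stable Q X" and d: "\<forall>q\<in>verts Q. dimvec (space X) q = 1"
    and a: "(\<Sum>i\<in>sources Q. level Q i) = a" and b: "(\<Sum>j\<in>sinks Q. level Q j) = b"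
    and ij: "(i, j) \<in> arrows Q"
  shows "sum (defect Q a b) (branch Q i j) < 0"
proof -
  define C where "C = branch Q i j"
  have adj: "adjacent Q i j" using ij by (simp add: adjacent_def)
  have C: "C \<subseteq> verts Q" "j \<in> C" "i \<notin> C"
    using branch_subset[OF adj] not_in_branch[OF adj] by (auto simp: C_def branch_self)
  define U where "U = (\<lambda>q. if q \<in> C then space X q else {0})"
  have rep: "representation Q X" using st by (simp add: stable_def)
  have subsp: "cvec.subspace (space X q)" if "q \<in> verts Q" for q
    using rep that by (simp add: representation_def)
  have nz: "space X q \<noteq> {0}" if "q \<in> verts Q" for q
    using d that dim_zero by (auto simp: dimvec_def)
  have "subrepresentation Q X U"
    unfolding subrepresentation_def
  proof (intro conjI ballI)
    fix q assume "q \<in> verts Q"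
    then show "cvec.subspace (U q)" "U q \<subseteq> space X q"
      using subsp cvec.subspace_0 cvec.subspace_single_0 by (auto simp: U_def)
  next
    fix p assume p: "p \<in> arrows Q"
    obtain u v where uv: "p = (u, v)" by force
    have lin: "Vector_Spaces.linear cscale cscale (lmap X (u, v))"
      and im: "lmap X (u, v) ` space X u \<subseteq> space X v"
      using bspec[OF conjunct2[OF rep[unfolded representation_def]] p] uv by simp_all
    have "lmap X (u, v) ` U u \<subseteq> U v"
    proof (cases "u \<in> C")
      case True
      \<comment> \<open>Since \<open>i\<close> is not in \<open>C\<close>, equality would make the
        source \<open>u\<close> equal to the sink \<open>j\<close>.\<close>
      have "{u, v} \<noteq> {i, j}"
        using True C p uv arrowD[of u v] arrowD[of i j] ij disjoint by (auto simp: doubleton_eq_iff)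
      then have "v \<in> C"
        using True p uv branch_step[of u Q i j v] by (auto simp: C_def adjacent_def)
      with True im show ?thesis by (simp add: U_def)
    next
      case False
      interpret l: Vector_Spaces.linear cscale cscale "lmap X (u, v)" by (rule lin)
      have "0 \<in> U v" using p uv arrowD(4)[of u v] subsp cvec.subspace_0 by (auto simp: U_def)
      with False show ?thesis by (simp add: U_def l.zero)
    qed
    with uv show "case p of (i, j) \<Rightarrow> lmap X (i, j) ` U i \<subseteq> U j" by simp
  qed
  moreover have "\<exists>q\<in>verts Q. U q \<noteq> {0}"
    using C nz by (intro bexI[of _ j]) (auto simp: U_def)
  moreover have "\<exists>q\<in>verts Q. U q \<noteq> space X q"
    using C nz arrowD[OF ij] by (intro bexI[of _ i]) (auto simp: U_def)
  ultimately have "slope Q (dimvec U) < slope Q (dimvec (space X))"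
    using st by (simp add: stable_def)
  moreover have "slope Q (dimvec U) < slope Q (dimvec (space X)) \<longleftrightarrow>
      b * (\<Sum>i\<in>sources Q \<inter> C. level Q i) < a * (\<Sum>j\<in>sinks Q \<inter> C. level Q j)"
    by (rule slope_less_iff[OF bip C(1) _ _ _ a b])
       (use C d in \<open>auto simp: dimvec_def U_def dim_zero\<close>)
  ultimately have "int (b * (\<Sum>i\<in>sources Q \<inter> C. level Q i)) < int (a * (\<Sum>j\<in>sinks Q \<inter> C. level Q j))"
    by (simp only: of_nat_less_iff)
  then show ?thesis using sum_defect[OF C(1)] by (simp add: C_def)
qed

text \<open>The value is forced: what the branch beyond \<open>j\<close> demands in excess of its
  own supply can enter only through \<open>(i, j)\<close>.\<close>

definition tree_flow :: "nat \<Rightarrow> nat \<Rightarrow> 'v \<Rightarrow> 'v \<Rightarrow> int" where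
  "tree_flow a b i j = (if (i, j) \<in> arrows Q then - sum (defect Q a b) (branch Q i j) else 0)"

text \<open>The total defect vanishes, so the defects of the branches around a vertex add up to
  minus its own defect. This is conservation of flow; positivity is
  \<open>stable_imp_defect_neg\<close>.\<close>

lemma positive_flow_tree_flow:
  assumes st: "stable Q X" and d: "\<forall>q\<in>verts Q. dimvec (space X) q = 1"
    and a: "(\<Sum>i\<in>sources Q. level Q i) = a" and b: "(\<Sum>j\<in>sinks Q. level Q j) = b"
  shows "positive_flow Q a b (tree_flow a b)"
proof -
  let ?f = "defect Q a b"
  have total: "sum ?f (verts Q) = 0"
  proof -
    have "sources Q \<inter> verts Q = sources Q" "sinks Q \<inter> verts Q = sinks Q" by (auto simp: verts_def)
    then show ?thesis using sum_defect[of "verts Q" a b] a b by (simp add: mult.commute)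
  qed
  have star: "(\<Sum>w\<in>neighbours Q v. sum ?f (branch Q v w)) = - ?f v" if "v \<in> verts Q" for v
  proof -
    have "(\<Sum>w\<in>neighbours Q v. sum ?f (branch Q v w)) = sum ?f (verts Q - {v})"
      by (simp add: sum_branches[symmetric] Union_branch[OF that])
    also have "\<dots> = - ?f v" using that total finite_verts by (simp add: sum_diff1)
    finally show ?thesis .
  qed
  have row: "(\<Sum>j\<in>sinks Q. tree_flow a b i j) = int (b * level Q i)" if i: "i \<in> sources Q" for i
  proof -
    have "(\<Sum>j\<in>sinks Q. tree_flow a b i j) = (\<Sum>j\<in>neighbours Q i. - sum ?f (branch Q i j))"
      using finite_sinks unfolding neighbours_source[OF i]
      by (intro sum.mono_neutral_cong_right) (auto simp: tree_flow_def)
    also have "\<dots> = ?f i" using star[of i] i by (simp add: sum_negf verts_def)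
    finally show ?thesis using i by (simp add: defect_def)
  qed
  have col: "(\<Sum>i\<in>sources Q. tree_flow a b i j) = int (a * level Q j)" if j: "j \<in> sinks Q" for j
  proof -
    \<comment> \<open>Around a sink the branches lie on the source side of the arrows; passing to
      the complement changes the sign.\<close>
    have opp: "- sum ?f (branch Q i j) = sum ?f (branch Q j i)" if "i \<in> neighbours Q j" for i
    proof -
      have adj: "adjacent Q i j" using that adjacent_sym[of Q i j] by (auto simp: neighbours_def)
      show ?thesis unfolding branch_opposite[OF adj]
        using branch_subset[OF adj] finite_verts total by (simp add: sum_diff)
    qed
    have "(\<Sum>i\<in>sources Q. tree_flow a b i j) = (\<Sum>i\<in>neighbours Q j. - sum ?f (branch Q i j))"
      using finite_sources unfolding neighbours_sink[OF j]
      by (intro sum.mono_neutral_cong_right) (auto simp: tree_flow_def)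
    also have "\<dots> = - ?f j" using star[of j] j opp by (simp add: verts_def)
    finally show ?thesis using j disjoint by (auto simp: defect_def)
  qed
  show ?thesis
    using row col stable_imp_defect_neg[OF st d a b] by (simp add: positive_flow_def tree_flow_def)
qed

lemma flow_sum_neq:
  assumes a: "(\<Sum>i\<in>sources Q. level Q i) = a" and b: "(\<Sum>j\<in>sinks Q. level Q j) = b"
    and cop: "coprime a b" and pos: "b > 0"
    and i: "i \<in> sources Q" "level Q i \<ge> 2" and S: "S \<subseteq> neighbours Q i"
  shows "(\<Sum>j\<in>S. tree_flow a b i j) \<noteq> int b"
proof
  assume eq: "(\<Sum>j\<in>S. tree_flow a b i j) = int b"
  define C where "C = (\<Union>j\<in>S. branch Q i j)"
  define s where "s = (\<Sum>i\<in>sources Q \<inter> C. level Q i)"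
  define t where "t = (\<Sum>j\<in>sinks Q \<inter> C. level Q j)"
  have C: "C \<subseteq> verts Q" "i \<notin> C"
    using S branch_subset not_in_branch by (force simp: C_def neighbours_def)+
  have "(\<Sum>j\<in>S. tree_flow a b i j) = - sum (defect Q a b) C"
    using S neighbours_source[OF i(1)] unfolding C_def sum_branches[OF S]
    by (auto simp: tree_flow_def sum_negf[symmetric] intro!: sum.cong)
  then have "int (a * t) = int (b * (s + 1))"
    using eq sum_defect[OF C(1), of a b] by (simp add: s_def t_def algebra_simps)
  then have at: "a * t = b * (s + 1)" by (simp only: of_nat_eq_iff)
  \<comment> \<open>Coprimality forces \<open>t >= b\<close>, hence \<open>a <= s + 1\<close>. But
    \<open>ik\<close>, here \<open>i\<close>, lies in none of its own branches, which leaves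
    \<open>s <= a - level Q i\<close>.\<close>
  then have "b dvd t" using cop by (metis coprime_commute coprime_dvd_mult_right_iff dvd_triv_left)
  moreover have "t > 0" using at pos by (cases t) auto
  ultimately have "b \<le> t" by (rule dvd_imp_le)
  then have "b * a \<le> b * (s + 1)" unfolding at[symmetric] by (simp add: mult.commute)
  then have "a \<le> s + 1" using pos by (simp only: mult_le_cancel1)
  moreover have "s + level Q i \<le> a"
  proof -
    have "s + level Q i = (\<Sum>q\<in>insert i (sources Q \<inter> C). level Q q)"
      using C finite_sources by (simp add: s_def)
    also have "\<dots> \<le> a" unfolding a[symmetric]
      using i finite_sources by (intro sum_mono2) auto
    finally show ?thesis .
  qed
  ultimately show False using i(2) by linarith
qed

end


section \<open>Splitting a source\<close>

text \<open>Sharing exactly one neighbour keeps the quiver a tree: sharing none would disconnect it,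
  sharing two would create a cycle.\<close>

locale split_tree = tree Q for Q :: "'v quiver" +
  fixes i i1 i2 jt :: 'v and J1 J2 :: "'v set"
  assumes i: "i \<in> sources Q" and lev: "level Q i \<ge> 2"
    and J: "J1 \<union> J2 = neighbours Q i" "J1 \<inter> J2 = {jt}"
    and new: "i1 \<notin> verts Q" "i2 \<notin> verts Q" "i1 \<noteq> i2"
begin

abbreviation "Q' \<equiv> split_source Q i i1 i2 J1 J2"

lemma J_subset: "J1 \<subseteq> sinks Q" "J2 \<subseteq> sinks Q" "J1 \<subseteq> neighbours Q i" "J2 \<subseteq> neighbours Q i"
  using J neighbours_source[OF i] by auto

lemma split_simps:
  "sources Q' = sources Q - {i} \<union> {i1, i2}" "sinks Q' = sinks Q"
  "arrows Q' = {(u, v) \<in> arrows Q. u \<noteq> i} \<union> {i1} \<times> J1 \<union> {i2} \<times> J2"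
  "level Q' = (level Q)(i1 := 1, i2 := level Q i - 1)"
  by (simp_all add: split_source_def)

lemma new': "i1 \<noteq> i" "i2 \<noteq> i" "i1 \<notin> sources Q" "i2 \<notin> sources Q" "i1 \<notin> sinks Q" "i2 \<notin> sinks Q"
  using new i by (auto simp: verts_def)

section \<open>The split quiver is again a bipartite tree\<close>

lemma bipartite_split: "bipartite_quiver Q'"
  using bip new' J_subset lev disjoint
  unfolding bipartite_quiver_def verts_def split_simps by auto

lemma verts_split: "verts Q' = verts Q - {i} \<union> {i1, i2}"
  using i disjoint by (auto simp: verts_def split_simps)

lemma connected_split: "connected_quiver Q'"
proof -
  let ?R = "(adjacent Q')\<^sup>*\<^sup>*"
  have sym: "?R u v \<Longrightarrow> ?R v u" for u v
    by (rule sympD[OF symp_rtranclp]) (auto intro!: sympI simp: adjacent_def)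
  \<comment> \<open>\<open>T u\<close> consists of the vertices of \<open>Q'\<close> lying over
    \<open>u\<close>; paths of \<open>Q\<close> starting at \<open>jt\<close> are lifted for all of
    them at once.\<close>
  define T where "T u = (if u = i then {i1, i2} else {u})" for u
  have jt: "jt \<in> J1" "jt \<in> J2" "jt \<noteq> i" "jt \<in> verts Q"
    using J J_subset i disjoint by (auto simp: verts_def)
  have base: "adjacent Q' i1 j" if "j \<in> J1" for j using that by (simp add: adjacent_def split_simps)
  have base2: "adjacent Q' i2 j" if "j \<in> J2" for j using that by (simp add: adjacent_def split_simps)
  have to_jt: "?R u' jt" if u: "u \<in> verts Q" and u': "u' \<in> T u" for u u'
  proof -
    have "(adjacent Q)\<^sup>*\<^sup>* jt u"
      using tree u jt by (simp add: tree_quiver_def connected_quiver_def)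
    then have "\<forall>u'\<in>T u. ?R u' jt"
    proof (induction rule: rtranclp_induct)
      case base
      then show ?case using jt by (simp add: T_def)
    next
      case (step y z)
      show ?case
      proof (cases "z = i")
        case True
        then show ?thesis using jt base base2 by (auto simp: T_def)
      next
        case False
        show ?thesis
        proof (cases "y = i")
          case True
          then have "z \<in> J1 \<union> J2" using step(2) by (simp add: J neighbours_def)
          then have "adjacent Q' i1 z \<or> adjacent Q' i2 z" using base base2 by blast
          then have "adjacent Q' z i1 \<or> adjacent Q' z i2" by (simp add: adjacent_sym)
          with step(3) True False show ?thesis
            by (auto simp: T_def intro: converse_rtranclp_into_rtranclp)
        next
          case yi: False
          have "adjacent Q' z y" using step(2) False yi by (auto simp: adjacent_def split_simps)
          with step(3) yi False show ?thesis
            by (auto simp: T_def intro: converse_rtranclp_into_rtranclp)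
        qed
      qed
    qed
    with u' show ?thesis by blast
  qed
  have "?R u jt" if "u \<in> verts Q'" for u
  proof -
    have "i \<in> verts Q" using i by (simp add: verts_def)
    with that to_jt[of i u] to_jt[of u u] show ?thesis by (auto simp: verts_split T_def)
  qed
  then show ?thesis unfolding connected_quiver_def by (meson sym rtranclp_trans)
qed

text \<open>An arrow inherited from \<open>Q\<close>, or one whose sink has only one of the new sources as neighbour,
  is cut by the preimage of a branch of \<open>Q\<close>; the two arrows into \<open>jt\<close> are cut by the union of the
  branches that belong to only one of the new sources.\<close>

lemma no_cycle_split: "\<not> is_cycle Q' vs"
proof (rule no_cycleI)
  \<comment> \<open>\<open>\<rho>\<close> merges the two new sources back into \<open>i\<close> and
    so maps arrows of \<open>Q'\<close> to arrows of \<open>Q\<close>.\<close>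
  define \<rho> where "\<rho> q = (if q = i1 \<or> q = i2 then i else q)" for q
  have \<rho>_arrow: "(\<rho> x, \<rho> y) \<in> arrows Q" if "(x, y) \<in> arrows Q'" for x y
    using that new' J_subset neighbours_source[OF i] arrowD
    by (auto simp: \<rho>_def split_simps)
  have \<rho>_sink: "\<rho> y = y" if "(x, y) \<in> arrows Q'" for x y
    using that new' J_subset arrowD[of x y] by (auto simp: \<rho>_def split_simps)
  \<comment> \<open>By \<open>uniq\<close>, no other arrow of \<open>Q'\<close> has the same image
    under \<open>\<rho>\<close>, so the preimage of the branch is crossed by \<open>(u, v)\<close>
    alone.\<close>
  have lift: "\<exists>A. (u \<in> A) \<noteq> (v \<in> A) \<and> (\<forall>(x, y)\<in>arrows Q' - {(u, v)}. x \<in> A \<longleftrightarrow> y \<in> A)"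
    if uv: "(u, v) \<in> arrows Q'"
      and uniq: "\<And>x. (x, v) \<in> arrows Q' \<Longrightarrow> \<rho> x = \<rho> u \<Longrightarrow> x = u" for u v
  proof -
    have arr: "(\<rho> u, v) \<in> arrows Q" using \<rho>_arrow[OF uv] \<rho>_sink[OF uv] by simp
    then have adj: "adjacent Q (\<rho> u) v" by (simp add: adjacent_def)
    define A where "A = {q. \<rho> q \<in> branch Q (\<rho> u) v}"
    have "u \<notin> A" "v \<in> A" using not_in_branch[OF adj] \<rho>_sink[OF uv] by (auto simp: A_def branch_self)
    moreover have "x \<in> A \<longleftrightarrow> y \<in> A" if xy: "(x, y) \<in> arrows Q'" "(x, y) \<noteq> (u, v)" for x y
    proof -
      have "(\<rho> x, y) \<in> arrows Q" using \<rho>_arrow[OF xy(1)] \<rho>_sink[OF xy(1)] by simp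
      moreover have "{\<rho> x, y} \<noteq> {\<rho> u, v}"
        using uniq[of x] xy calculation arr arrowD[of "\<rho> x" y] arrowD[of "\<rho> u" v] disjoint
        by (auto simp: doubleton_eq_iff)
      ultimately show ?thesis
        using branch_arrow_iff[OF adj] \<rho>_sink[OF xy(1)] by (simp add: A_def)
    qed
    ultimately show ?thesis by blast
  qed
  \<comment> \<open>One argument for both new sources: \<open>p\<close> is the one considered,
    \<open>K\<close> its private neighbours, \<open>r\<close> the other one.\<close>
  have shared: "\<exists>A. (p \<in> A) \<noteq> (jt \<in> A) \<and> (\<forall>(x, y)\<in>arrows Q' - {(p, jt)}. x \<in> A \<longleftrightarrow> y \<in> A)"
    if p: "p = i1 \<and> K = J1 - {jt} \<and> r = i2 \<or> p = i2 \<and> K = J2 - {jt} \<and> r = i1" for p r K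
  proof -
    define B where "B = (\<Union>j\<in>K. branch Q i j)"
    have K: "K \<subseteq> neighbours Q i" "jt \<in> neighbours Q i" "jt \<notin> K" using p J by auto
    have B: "B \<subseteq> verts Q" "i \<notin> B"
      using K branch_subset not_in_branch by (force simp: B_def neighbours_def)+
    have Bout: "j \<in> B \<longleftrightarrow> j \<in> K" if "j \<in> neighbours Q i" for j
      using that K disjoint_branches[of i j] branch_self by (fastforce simp: B_def neighbours_def)
    have Biff: "x \<in> B \<longleftrightarrow> y \<in> B" if "(x, y) \<in> arrows Q" "x \<noteq> i" for x y
    proof -
      have "x \<in> branch Q i j \<longleftrightarrow> y \<in> branch Q i j" if j: "j \<in> K" for j
      proof (rule branch_arrow_iff[OF _ \<open>(x, y) \<in> arrows Q\<close>])
        show "adjacent Q i j" using j K by (auto simp: neighbours_def)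
        show "{x, y} \<noteq> {i, j}"
          using \<open>x \<noteq> i\<close> arrowD[OF \<open>(x, y) \<in> arrows Q\<close>] i disjoint by (auto simp: doubleton_eq_iff)
      qed
      then show ?thesis by (auto simp: B_def)
    qed
    define A where "A = insert p B"
    have pr: "p \<notin> verts Q" "r \<notin> verts Q" "p \<noteq> r" "r \<notin> B" using p new B by auto
    have sinkA: "y \<in> A \<longleftrightarrow> y \<in> B" if "y \<in> sinks Q" for y
      using that pr by (auto simp: A_def verts_def)
    have "jt \<in> sinks Q" using K(2) neighbours_source[OF i] by simp
    then have "p \<in> A" "jt \<notin> A" using Bout[of jt] K sinkA[of jt] by (auto simp: A_def)
    moreover have "x \<in> A \<longleftrightarrow> y \<in> A" if xy: "(x, y) \<in> arrows Q'" "(x, y) \<noteq> (p, jt)" for x y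
    proof -
      \<comment> \<open>Arrows of \<open>r\<close> end outside \<open>K\<close>, because
        \<open>jt\<close> is the only common neighbour.\<close>
      consider (old) "(x, y) \<in> arrows Q" "x \<noteq> i" | (own) "x = p" "y \<in> K"
        | (other) "x = r" "y \<in> neighbours Q i" "y \<notin> K"
        using xy p J new(3) by (auto simp: split_simps)
      then show ?thesis
      proof cases
        case old
        then have "x \<noteq> p" "y \<in> sinks Q" using arrowD[of x y] pr by auto
        with Biff[OF old] sinkA show ?thesis by (simp add: A_def)
      next
        case own
        then show ?thesis using Bout K by (auto simp: A_def)
      next
        case other
        then have "y \<in> sinks Q" using neighbours_source[OF i] by simp
        with other Bout pr sinkA show ?thesis by (auto simp: A_def)
      qed
    qed
    ultimately show ?thesis by blast
  qed
  show "\<exists>A. (u \<in> A) \<noteq> (v \<in> A) \<and> (\<forall>(x, y)\<in>arrows Q' - {(u, v)}. x \<in> A \<longleftrightarrow> y \<in> A)"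
    if uv: "(u, v) \<in> arrows Q'" for u v
  proof (cases "v = jt \<and> (u = i1 \<or> u = i2)")
    case True
    then show ?thesis using shared[of u] by auto
  next
    case False
    show ?thesis
    proof (rule lift[OF uv])
      show "x = u" if "(x, v) \<in> arrows Q'" "\<rho> x = \<rho> u" for x
        using that uv False J new' arrowD by (auto simp: \<rho>_def split_simps split: if_splits)
    qed
  qed
next
  show "(v, u) \<notin> arrows Q'" if "(u, v) \<in> arrows Q'" for u v
    using that bipartite_split unfolding bipartite_quiver_def by auto
qed

lemma tree_split: "tree_quiver Q'"
  using connected_split no_cycle_split by (auto simp: tree_quiver_def verts_split)

section \<open>Levels and flow of the split quiver\<close>

lemma count_split:
  assumes cnt: "card {q\<in>sources Q. level Q q = l} = p l" and pk: "p (level Q i) \<noteq> 0"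
  shows "card {q\<in>sources Q'. level Q' q = l} = split_part (level Q i) p l"
proof -
  have card_eq: "int (card {q\<in>S. f q = l}) = (\<Sum>q\<in>S. of_bool (f q = l))"
    if "finite S" for S and f :: "'a \<Rightarrow> nat"
    using that by (simp add: Int_def)
  have "int (card {q\<in>sources Q'. level Q' q = l}) = (\<Sum>q\<in>sources Q'. of_bool (level Q' q = l))"
    using bipartite_split by (intro card_eq) (simp add: bipartite_quiver_def)
  also have "\<dots> = (\<Sum>q\<in>sources Q - {i}. of_bool (level Q' q = l))
      + of_bool (level Q' i1 = l) + of_bool (level Q' i2 = l)"
    using finite_sources new' new(3) by (simp add: split_simps(1))
  also have "(\<Sum>q\<in>sources Q - {i}. of_bool (level Q' q = l)) =
      (\<Sum>q\<in>sources Q - {i}. of_bool (level Q q = l) :: int)"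
    using new' by (intro sum.cong) (auto simp: split_simps(4))
  also have "\<dots> = (\<Sum>q\<in>sources Q. of_bool (level Q q = l)) - of_bool (level Q i = l)"
    by (simp only: sum_diff1[OF finite_sources] i if_True)
  also have "(\<Sum>q\<in>sources Q. of_bool (level Q q = l)) = int (p l)"
    by (simp only: card_eq[OF finite_sources, symmetric] cnt)
  finally have "int (card {q\<in>sources Q'. level Q' q = l}) = int (split_part (level Q i) p l)"
    using split_part_eq[of "level Q i" p l] lev pk new(3) by (auto simp: split_simps(4))
  then show ?thesis by (simp only: of_nat_eq_iff)
qed

text \<open>The level-\<open>1\<close> source must emit exactly \<open>b\<close>: it takes over all
  flow to \<open>J1 - {jt}\<close> and tops it up at \<open>jt\<close>. The bounds
  \<open>less\<close> and \<open>gr\<close> say that both shares of \<open>jt\<close> are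
  positive.\<close>

lemma flow_split:
  assumes flow: "positive_flow Q a b x"
    and less: "(\<Sum>j\<in>J1 - {jt}. x i j) < int b" and gr: "(\<Sum>j\<in>J1. x i j) > int b"
  shows "\<exists>x'. positive_flow Q' a b x'"
proof -
  have fin: "finite J1" using J_subset finite_sinks finite_subset by blast
  have jt: "jt \<in> J1" "jt \<in> J2" using J by auto
  \<comment> \<open>\<open>y\<close> is the outflow of \<open>i1\<close>; what remains of the
    outflow of \<open>i\<close> goes to \<open>i2\<close>.\<close>
  define y where "y j = (if j = jt then int b - (\<Sum>j\<in>J1 - {jt}. x i j)
    else if j \<in> J1 then x i j else 0)" for j
  define x' where "x' u j = (if u = i1 then y j else if u = i2 then x i j - y j else x u j)" for u j
  have gr': "x i jt > y jt" using gr fin jt by (simp add: y_def sum.remove)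
  have arr: "(u, j) \<in> arrows Q \<Longrightarrow> x u j > 0" "(u, j) \<notin> arrows Q \<Longrightarrow> x u j = 0"
    if "u \<in> sources Q" "j \<in> sinks Q" for u j
    using flow that by (auto simp: positive_flow_def)
  have nb: "(i, j) \<in> arrows Q \<longleftrightarrow> j \<in> J1 \<or> j \<in> J2" if "j \<in> sinks Q" for j
    using that J neighbours_source[OF i] by auto
  have sum_y: "sum y (sinks Q) = int b"
  proof -
    have "sum y (sinks Q) = sum y J1"
      using J_subset finite_sinks jt by (intro sum.mono_neutral_right) (auto simp: y_def)
    also have "\<dots> = y jt + (\<Sum>j\<in>J1 - {jt}. x i j)"
      using fin jt by (simp add: sum.remove[of J1 jt] y_def)
    finally show ?thesis by (simp add: y_def)
  qed
  have row_i: "(\<Sum>j\<in>sinks Q. x i j) = int (b * level Q i)"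
    using flow i by (simp add: positive_flow_def)
  have "positive_flow Q' a b x'"
    unfolding positive_flow_def
  proof (intro conjI ballI)
    fix u j assume u: "u \<in> sources Q'" and j: "j \<in> sinks Q'"
    then have j': "j \<in> sinks Q" by (simp add: split_simps)
    consider (old) "u \<in> sources Q" "u \<noteq> i" "u \<noteq> i1" "u \<noteq> i2" | (i1) "u = i1" | (i2) "u = i2"
      using u new' by (auto simp: split_simps)
    then show "if (u, j) \<in> arrows Q' then x' u j > 0 else x' u j = 0"
    proof cases
      case old
      then show ?thesis using arr[OF _ j'] by (auto simp: x'_def split_simps)
    next
      case i1
      then have "(u, j) \<in> arrows Q' \<longleftrightarrow> j \<in> J1"
        using new' new(3) arrowD(1)[of i1 j] by (auto simp: split_simps)
      then show ?thesis
        using i1 jt less arr(1)[OF i j'] nb[OF j'] by (auto simp: x'_def y_def)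
    next
      case i2
      have eq: "(u, j) \<in> arrows Q' \<longleftrightarrow> j \<in> J2"
        using i2 new' new(3) arrowD(1)[of i2 j] by (auto simp: split_simps)
      have x'_eq: "x' u j = x i j - y j" using i2 new(3) by (simp add: x'_def)
      show ?thesis
      proof (cases "j = jt")
        case True
        then show ?thesis using eq x'_eq jt gr' by simp
      next
        case False
        then have "\<not> (j \<in> J1 \<and> j \<in> J2)" using J by auto
        with False show ?thesis
          using eq x'_eq arr[OF i j'] nb[OF j'] by (auto simp: y_def)
      qed
    qed
  next
    fix u assume "u \<in> sources Q'"
    then consider (old) "u \<in> sources Q" "u \<noteq> i1" "u \<noteq> i2" | (i1) "u = i1" | (i2) "u = i2"
      using new' by (auto simp: split_simps)
    then show "(\<Sum>j\<in>sinks Q'. x' u j) = int (b * level Q' u)"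
    proof cases
      case old
      then show ?thesis using flow by (simp add: x'_def split_simps positive_flow_def)
    next
      case i1
      then show ?thesis using sum_y new(3) by (simp add: x'_def split_simps)
    next
      case i2
      then show ?thesis using sum_y row_i new(3) lev
        by (simp add: x'_def split_simps sum_subtractf of_nat_diff algebra_simps)
    qed
  next
    fix j assume "j \<in> sinks Q'"
    then have j: "j \<in> sinks Q" by (simp add: split_simps)
    have "(\<Sum>u\<in>sources Q'. x' u j) = (\<Sum>u\<in>sources Q - {i}. x' u j) + x' i1 j + x' i2 j"
      using finite_sources new' new(3) by (simp add: split_simps(1))
    \<comment> \<open>At every sink the two shares add up to the flow formerly coming from
      \<open>i\<close>.\<close>
    also have "\<dots> = (\<Sum>u\<in>sources Q - {i}. x u j) + x i j"
      using new' new(3) by (auto simp: x'_def intro!: sum.cong split: if_splits)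
    also have "\<dots> = (\<Sum>u\<in>sources Q. x u j)"
      using finite_sources i by (simp add: sum.remove)
    also have "\<dots> = int (a * level Q' j)"
      using flow j new' by (auto simp: positive_flow_def split_simps)
    finally show "(\<Sum>u\<in>sources Q'. x' u j) = int (a * level Q' j)" .
  qed
  then show ?thesis by blast
qed

end

section \<open>Choice of the shared sink and conclusion\<close>

theorem lemma4p1:
  fixes a b k :: nat and al bl :: "nat \<Rightarrow> nat"
    and Q :: "'v quiver" and d :: "'v \<Rightarrow> nat" and ik :: 'v
  assumes "a > 0" and "b > 0" and "coprime a b"
    and "weighted_partition a al" and "weighted_partition b bl"
    and "localization_data al bl Q d"
    and "k \<ge> 2" and "al k \<noteq> 0"
    and "ik \<in> sources Q" and "level Q ik = k"
  shows "weighted_partition a (split_part k al) \<and>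
    (\<exists>jt J1 J2. jt \<in> sinks Q \<and> jt \<in> neighbours Q ik \<and>
       J1 \<subseteq> neighbours Q ik \<and> J2 \<subseteq> neighbours Q ik \<and>
       neighbours Q ik = J1 \<union> J2 \<and> J1 \<inter> J2 = {jt} \<and>
       (\<forall>i1 i2. i1 \<notin> verts Q \<and> i2 \<notin> verts Q \<and> i1 \<noteq> i2 \<longrightarrow>
          localization_data (split_part k al) bl (split_source Q ik i1 i2 J1 J2)
            (d(i1 := 1, i2 := 1))))"
proof -
  have wp': "weighted_partition a (split_part k al)"
    using assms by (intro weighted_partition_split_part)
  from assms(6) obtain X where bip: "bipartite_quiver Q" and tree: "tree_quiver Q"
    and cnt: "\<And>l. l \<ge> 1 \<Longrightarrow> card {i\<in>sources Q. level Q i = l} = al l"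
      "\<And>l. l \<ge> 1 \<Longrightarrow> card {j\<in>sinks Q. level Q j = l} = bl l"
    and d: "\<forall>q\<in>verts Q. d q = 1"
    and X: "stable Q X" "\<forall>q\<in>verts Q. dimvec (space X) q = 1"
    unfolding localization_data_def by auto
  interpret tree Q by unfold_locales (fact bip tree)+
  have lev: "\<forall>q\<in>verts Q. level Q q \<ge> 1" using bip by (simp add: bipartite_quiver_def)
  have a: "(\<Sum>i\<in>sources Q. level Q i) = a"
    using finite_sources assms(4) cnt lev by (intro sum_level_eq) (auto simp: verts_def)
  have b: "(\<Sum>j\<in>sinks Q. level Q j) = b"
    using finite_sinks assms(5) cnt lev by (intro sum_level_eq) (auto simp: verts_def)
  define x where "x = tree_flow a b"
  have flow: "positive_flow Q a b x"
    unfolding x_def using positive_flow_tree_flow[OF X a b] .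
  define N where "N = neighbours Q ik"
  have finN: "finite N" by (simp add: N_def finite_neighbours)
  have "sum (x ik) N = (\<Sum>j\<in>sinks Q. x ik j)"
    using finite_sinks flow assms(9) unfolding N_def neighbours_source[OF assms(9)]
    by (intro sum.mono_neutral_left) (auto simp: positive_flow_def split: if_splits)
  also have "\<dots> = int (b * k)" using flow assms(9,10) by (simp add: positive_flow_def)
  finally have sumN: "sum (x ik) N = int (b * k)" .
  define P where "P S \<longleftrightarrow> S \<subseteq> N \<and> sum (x ik) S < int b" for S
  have "P {}" using assms(2) by (simp add: P_def)
  moreover have "\<forall>S. P S \<longrightarrow> card S \<le> card N" by (auto simp: P_def intro: card_mono finN)
  \<comment> \<open>Maximality is by cardinality; the bound is \<open>Suc (card N)\<close> because
    \<open>ex_has_greatest_nat\<close> asks for a strict one.\<close>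
  ultimately obtain S where S: "P S" and max: "\<And>S'. P S' \<Longrightarrow> card S' \<le> card S"
    using ex_has_greatest_nat[of P "{}" card "Suc (card N)"] by (auto simp: less_Suc_eq_le)
  have finS: "finite S" using S finN by (auto simp: P_def intro: finite_subset)
  \<comment> \<open>All neighbours together receive \<open>b * k\<close>, which is not less than
    \<open>b\<close>.\<close>
  have "S \<noteq> N"
  proof
    assume "S = N"
    then have "int (b * k) < int b" using S sumN by (simp add: P_def)
    then show False using assms(7) by (simp only: of_nat_less_iff) auto
  qed
  then obtain jt where jt: "jt \<in> N" "jt \<notin> S" using S by (auto simp: P_def)
  define J1 where "J1 = insert jt S"
  define J2 where "J2 = N - S"
  \<comment> \<open>By maximality, adding \<open>jt\<close> brings the sum to at least
    \<open>b\<close>; equality is then excluded by \<open>flow_sum_neq\<close>.\<close>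
  have "\<not> P J1" using max[of J1] finS jt by (auto simp: J1_def)
  moreover have "J1 \<subseteq> N" using S jt by (auto simp: J1_def P_def)
  moreover have "sum (x ik) J1 \<noteq> int b"
    using flow_sum_neq[OF a b assms(3,2,9)] assms(7,10) \<open>J1 \<subseteq> N\<close> by (simp add: x_def N_def)
  ultimately have gr: "sum (x ik) J1 > int b" by (simp add: P_def)
  have less: "sum (x ik) (J1 - {jt}) < int b" using S jt by (simp add: J1_def P_def)
  have J: "J1 \<union> J2 = N" "J1 \<inter> J2 = {jt}" using S jt by (auto simp: J1_def J2_def P_def)
  have "localization_data (split_part k al) bl (split_source Q ik i1 i2 J1 J2) (d(i1 := 1, i2 := 1))"
    if new: "i1 \<notin> verts Q" "i2 \<notin> verts Q" "i1 \<noteq> i2" for i1 i2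
  proof -
    interpret split_tree Q ik i1 i2 jt J1 J2
      using assms J new by unfold_locales (auto simp: N_def)
    have counts: "\<forall>l\<ge>1. card {i\<in>sources Q'. level Q' i = l} = split_part k al l \<and>
        card {j\<in>sinks Q'. level Q' j = l} = bl l"
    proof (intro allI impI conjI)
      fix l :: nat assume l: "l \<ge> 1"
      show "card {i\<in>sources Q'. level Q' i = l} = split_part k al l"
        using count_split[of l al] cnt(1)[OF l] assms(8,10) by simp
      have "{j\<in>sinks Q'. level Q' j = l} = {j\<in>sinks Q. level Q j = l}"
        using new' by (auto simp: split_simps)
      then show "card {j\<in>sinks Q'. level Q' j = l} = bl l" using cnt(2)[OF l] by simp
    qed
    have lev': "\<forall>q\<in>verts Q'. level Q' q \<ge> 1" and fin': "finite (sources Q')" "finite (sinks Q')"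
      using bipartite_split by (auto simp: bipartite_quiver_def)
    have a': "(\<Sum>i\<in>sources Q'. level Q' i) = a"
      using fin' wp' counts lev' by (intro sum_level_eq) (auto simp: verts_def)
    have b': "(\<Sum>j\<in>sinks Q'. level Q' j) = b"
      using fin' assms(5) counts lev' by (intro sum_level_eq) (auto simp: verts_def)
    obtain x' where "positive_flow Q' a b x'" using flow_split[OF flow less gr] by blast
    then obtain X' where "stable Q' X'" "\<forall>q\<in>verts Q'. dimvec (space X') q = 1"
      using flow_imp_stable[OF bipartite_split connected_split _ a' b'] by (auto simp: verts_split)
    moreover have "\<forall>q\<in>verts Q'. (d(i1 := 1, i2 := 1)) q = 1" using d by (auto simp: verts_split)
    ultimately show ?thesis
      unfolding localization_data_def using bipartite_split tree_split counts by auto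
  qed
  moreover have "jt \<in> sinks Q" using jt neighbours_source[OF assms(9)] by (simp add: N_def)
  ultimately show ?thesis
    using wp' jt(1) J unfolding N_def
    by (intro conjI exI[of _ jt] exI[of _ J1] exI[of _ J2]) auto
qed

end
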